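(* Let $F_q$ be a finite field with $q$ elements and let $R$ be a finite noncommutative associative algebra with unity over $F_q$, having $q^n$ elements. Let $C$ be the center of $R$, let $I_q = \{x \in R \mid x^q = x\}$, and let $r_q = \frac{|I_q|}{|R|}$. Then $r_q \leq \frac{q^2 - q + 1}{q^2}$. Further, if $r_q = \frac{q^2 - q + 1}{q^2}$, then $R$ is generated as an algebra by the center $C$ and two non-commuting elements $b, c \in I_q$ such that $C \subseteq I_q$, $|C| = q^{n-2}$ and $|C_b| = |C_c| = q^{n-1}$.
   Context: For an element $b$ of a ring $R$, $C_b$ denotes the set of all elements of $R$ which commute with $b$. All rings and algebras are associative with unity. *)

theory Defs
  imports Complex_Main "HOL-Library.Cardinality"
begin

text \<open>
  Associative unital algebras over a field, not necessarily commutative: the ring is a type of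
  class \<^class>\<open>ring_1\<close>, and the scalar action is an explicit parameter.
\<close>

locale unital_algebra = vector_space scale
  for scale :: "'f::field \<Rightarrow> 'r::ring_1 \<Rightarrow> 'r" (infixr \<open>*s\<close> 75) +
  assumes scale_mult_left: "(a *s x) * y = a *s (x * y)"
    and scale_mult_right: "x * (a *s y) = a *s (x * y)"

definition unital_subalgebra :: "('f::field \<Rightarrow> 'r::ring_1 \<Rightarrow> 'r) \<Rightarrow> 'r set \<Rightarrow> bool" where
  "unital_subalgebra scale S \<longleftrightarrow>
     module.subspace scale S \<and> 1 \<in> S \<and> (\<forall>x\<in>S. \<forall>y\<in>S. x * y \<in> S)"

definition generated_algebra :: "('f::field \<Rightarrow> 'r::ring_1 \<Rightarrow> 'r) \<Rightarrow> 'r set \<Rightarrow> 'r set" where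
  "generated_algebra scale X = unital_subalgebra scale hull X"

definition ring_center :: "'r::ring_1 set" where
  "ring_center = {z. \<forall>x. z * x = x * z}"

definition centralizer :: "'r::ring_1 \<Rightarrow> 'r set" where
  "centralizer b = {x. x * b = b * x}"

definition power_fixed :: "nat \<Rightarrow> 'r::ring_1 set" where
  "power_fixed q = {x. x ^ q = x}"

definition power_fixed_ratio :: "'r::{ring_1,finite} itself \<Rightarrow> nat \<Rightarrow> real" where
  "power_fixed_ratio _ q = real (card (power_fixed q :: 'r set)) / real CARD('r)"

end

theory Submission
  imports Defs "HOL-Computational_Algebra.Polynomial"
begin

text \<open>
  Write \<open>F\<close> for the field, \<open>q\<close> for its order, \<open>N\<close> for the order of \<open>R\<close>, and \<open>I\<close> for the set of solutions of
  \<open>x ^ q = x\<close> in \<open>R\<close>.  The proof compares \<open>I\<close> with the lines \<open>{c + t b}\<close>, where \<open>t\<close> runs through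
  \<open>F\<close>.

  The key point (\<open>commute_if_line_power_fixed\<close>) is that for \<open>b \<in> I\<close> a line \<open>{c + t b}\<close> lies entirely in \<open>I\<close>
  only if \<open>c\<close> commutes with \<open>b\<close>.  Summing \<open>(c + t b) ^ q = c + t b\<close> over all \<open>t\<close> and using the power
  sums of a finite field isolates the coefficient of \<open>t ^ (q - 1)\<close>, so that
  \<open>S = (\<Sum>i\<le>q - 1. b ^ i * c * b ^ (q - 1 - i))\<close> vanishes.  But \<open>b * S - S * b\<close> telescopes to
  \<open>b ^ q * c - c * b ^ q = b * c - c * b\<close>.

  Let \<open>b \<in> I\<close> be noncentral with centralizer \<open>Z\<close>.  Outside \<open>Z\<close> every line in direction \<open>b\<close> misses
  \<open>I\<close> at least once, so at least the fraction \<open>1 / q\<close> of the complement of \<open>Z\<close> lies outside \<open>I\<close>;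
  and \<open>q * card Z \<le> N\<close>, as \<open>Z\<close> is a proper subspace.  Together,
  \<open>q^2 * card I \<le> (q^2 - q + 1) * N\<close> (\<open>extremal_centralizer\<close>).  If \<open>I\<close> is central, it lies in a proper
  subspace and the inequality is strict.

  Equality forces \<open>Z \<subseteq> I\<close> and \<open>q * card Z = N\<close>, for every noncentral \<open>b \<in> I\<close>.  By the key point a
  subspace contained in \<open>I\<close> is commutative.  For noncommuting \<open>b, c \<in> I\<close> the two centralizers are thus
  commutative hyperplanes; an element of both commutes with the centralizer of \<open>b\<close> and with \<open>c\<close>, which together span
  \<open>R\<close>, so it is central.  Hence the center has codimension two, and with \<open>b\<close> and \<open>c\<close> it spans \<open>R\<close>.
\<close>

section \<open>Power sums over a finite field\<close>

text \<open>
  Multiplication by \<open>t\<close> permutes the nonzero elements, so it does not change their product.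
\<close>

lemma finite_field_power_card_minus_1:
  fixes t :: "'f::field"
  assumes fin: "finite (UNIV :: 'f set)" and t: "t \<noteq> 0"
  shows "t ^ (CARD('f) - 1) = 1"
proof -
  have fin': "finite (UNIV - {0} :: 'f set)"
    using fin by simp
  have "bij_betw (\<lambda>x. t * x) (UNIV - {0}) (UNIV - {0})"
    by (rule bij_betw_byWitness[where f' = "\<lambda>x. x / t"]) (use t in auto)
  then have "(\<Prod>x\<in>UNIV - {0}. t * x) = \<Prod>(UNIV - {0})"
    by (rule prod.reindex_bij_betw)
  moreover have "(\<Prod>x\<in>UNIV - {0}. t * x) = t ^ (CARD('f) - 1) * \<Prod>(UNIV - {0})"
    using fin by (simp add: prod.distrib card_Diff_singleton)
  moreover have "\<Prod>(UNIV - {0 :: 'f}) \<noteq> 0"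
    using fin' by simp
  ultimately show ?thesis
    by simp
qed

lemma finite_field_power_card:
  fixes t :: "'f::field"
  assumes fin: "finite (UNIV :: 'f set)"
  shows "t ^ CARD('f) = t"
proof (cases "t = 0")
  case True
  then show ?thesis
    using fin by (simp add: finite_UNIV_card_ge_0)
next
  case False
  have "CARD('f) = Suc (CARD('f) - 1)"
    using fin by (simp add: finite_UNIV_card_ge_0)
  then have "t ^ CARD('f) = t * t ^ (CARD('f) - 1)"
    by (metis power_Suc)
  then show ?thesis
    using finite_field_power_card_minus_1[OF fin False] by simp
qed

lemma two_le_card_field:
  assumes "finite (UNIV :: 'f::field set)"
  shows "2 \<le> CARD('f)"
proof -
  have "card {0 :: 'f, 1} \<le> CARD('f)"
    using assms by (intro card_mono) auto
  then show ?thesis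
    by simp
qed

text \<open>
  The translation \<open>t \<mapsto> t + 1\<close> does not change the sum of all field elements.
\<close>

lemma finite_field_of_nat_card:
  assumes fin: "finite (UNIV :: 'f::field set)"
  shows "(of_nat CARD('f) :: 'f) = 0"
proof -
  have "bij_betw (\<lambda>t::'f. t + 1) UNIV UNIV"
    by (rule bij_betw_byWitness[where f' = "\<lambda>t. t - 1"]) auto
  then have "(\<Sum>t\<in>UNIV. t + (1::'f)) = \<Sum>UNIV"
    by (rule sum.reindex_bij_betw)
  then show ?thesis
    by (simp add: sum.distrib)
qed

text \<open>
  For \<open>0 < i < q - 1\<close> the polynomial \<open>X ^ i - 1\<close> has too few roots to vanish on all nonzero elements.
  The substitution \<open>t \<mapsto> g * t\<close> with \<open>g ^ i \<noteq> 1\<close> then multiplies the sum by \<open>g ^ i\<close> without changing it.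
  For \<open>i = 0\<close> all terms, including \<open>0 ^ 0\<close>, are \<open>1\<close>.
\<close>

lemma finite_field_power_sum_eq_0:
  fixes i :: nat
  assumes fin: "finite (UNIV :: 'f::field set)" and i: "i < CARD('f) - 1"
  shows "(\<Sum>t\<in>UNIV. (t::'f) ^ i) = 0"
proof (cases "i = 0")
  case True
  then show ?thesis
    using finite_field_of_nat_card[OF fin] by simp
next
  case False
  define p :: "'f poly" where "p = monom 1 i - 1"
  have deg: "degree p \<le> i"
    unfolding p_def by (intro degree_diff_le) (auto simp: degree_monom_le)
  have "coeff p i = 1"
    using False by (simp add: p_def)
  then have "p \<noteq> 0"
    by auto
  then have "card {x. poly p x = 0} \<le> i"
    using card_poly_roots_bound deg le_trans by blast
  then have "card {x. poly p x = 0} < card (UNIV - {0 :: 'f})"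
    using i fin by (simp add: card_Diff_singleton)
  then have "\<not> UNIV - {0} \<subseteq> {x. poly p x = 0}"
    using card_mono fin by (metis finite_subset leD subset_UNIV)
  then obtain g :: 'f where g: "g \<noteq> 0" "g ^ i \<noteq> 1"
    by (auto simp: p_def poly_monom)
  have "bij_betw (\<lambda>x. g * x) UNIV UNIV"
    by (rule bij_betw_byWitness[where f' = "\<lambda>x. x / g"]) (use g in auto)
  then have "(\<Sum>t\<in>UNIV. (g * t) ^ i) = (\<Sum>t\<in>UNIV. t ^ i)"
    by (rule sum.reindex_bij_betw)
  then have "g ^ i * (\<Sum>t\<in>UNIV. t ^ i) = (\<Sum>t\<in>UNIV. t ^ i)"
    by (simp add: power_mult_distrib sum_distrib_left)
  then show ?thesis
    using g by simp
qed

lemma finite_field_power_sum_card_minus_1: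
  assumes fin: "finite (UNIV :: 'f::field set)"
  shows "(\<Sum>t\<in>UNIV. (t::'f) ^ (CARD('f) - 1)) = - 1"
proof -
  have q: "2 \<le> CARD('f)"
    by (rule two_le_card_field[OF fin])
  have "(\<Sum>t\<in>UNIV. (t::'f) ^ (CARD('f) - 1))
      = 0 ^ (CARD('f) - 1) + (\<Sum>t\<in>UNIV - {0}. (t::'f) ^ (CARD('f) - 1))"
    using fin by (subst sum.remove[of _ 0]) auto
  also have "\<dots> = (\<Sum>t\<in>UNIV - {0::'f}. 1)"
    using finite_field_power_card_minus_1[OF fin] q by simp
  also have "\<dots> = of_nat CARD('f) - 1"
    using fin q by (simp add: card_Diff_singleton)
  finally show ?thesis
    using finite_field_of_nat_card[OF fin] by simp
qed

section \<open>Lines consisting of solutions of \<open>x ^ q = x\<close>\<close>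

lemma commutator_power_eq_telescope:
  fixes b c :: "'r::ring_1"
  shows "b * (\<Sum>i\<le>m. b ^ i * c * b ^ (m - i)) - (\<Sum>i\<le>m. b ^ i * c * b ^ (m - i)) * b
    = b ^ Suc m * c - c * b ^ Suc m"
proof -
  let ?f = "\<lambda>i. b ^ i * c * b ^ (Suc m - i)"
  have "(\<Sum>i\<le>m. b ^ i * c * b ^ (m - i)) * b = (\<Sum>i\<le>m. ?f i)"
    unfolding sum_distrib_right
    by (intro sum.cong) (auto simp: mult.assoc power_Suc2[symmetric] Suc_diff_le simp del: power_Suc)
  moreover have "b * (\<Sum>i\<le>m. b ^ i * c * b ^ (m - i)) = (\<Sum>i\<le>m. ?f (Suc i))"
    unfolding sum_distrib_left by (intro sum.cong) (auto simp: mult.assoc)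
  ultimately have "b * (\<Sum>i\<le>m. b ^ i * c * b ^ (m - i)) - (\<Sum>i\<le>m. b ^ i * c * b ^ (m - i)) * b
      = (\<Sum>i\<le>m. ?f (Suc i) - ?f i)"
    by (simp add: sum_subtractf)
  also have "\<dots> = ?f (Suc m) - ?f 0"
    using sum_lessThan_telescope[of ?f "Suc m"] by (simp only: lessThan_Suc_atMost)
  finally show ?thesis
    by simp
qed

context unital_algebra
begin

text \<open>
  The expansion of \<open>(c + t b) ^ (m + 1)\<close> in powers of the central parameter \<open>t\<close>.  Only its two leading
  coefficients matter: the coefficient of \<open>t ^ m\<close> collects the words with exactly one factor \<open>c\<close>.  The
  coefficients \<open>v i\<close> of the lower powers do not depend on \<open>t\<close>, so the power sums will annihilate them.
\<close>

lemma power_on_line_expansion: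
  obtains v where
    "\<And>t. (c + t *s b) ^ Suc m = t ^ Suc m *s b ^ Suc m
        + t ^ m *s (\<Sum>i\<le>m. b ^ i * c * b ^ (m - i)) + (\<Sum>i<m. t ^ i *s v i)"
proof -
  let ?S = "\<lambda>m. \<Sum>i\<le>m. b ^ i * c * b ^ (m - i)"
  have "\<exists>v. \<forall>t. (c + t *s b) ^ Suc m = t ^ Suc m *s b ^ Suc m + t ^ m *s ?S m + (\<Sum>i<m. t ^ i *s v i)"
  proof (induction m)
    case 0
    show ?case
      by simp
  next
    case (Suc m)
    then obtain v where v: "\<And>t. (c + t *s b) ^ Suc m
        = t ^ Suc m *s b ^ Suc m + t ^ m *s ?S m + (\<Sum>i<m. t ^ i *s v i)"
      by blast
    \<comment> \<open>The low coefficients of \<open>c + t b\<close> times the expansion for \<open>m\<close>; the term \<open>c * ?S m\<close> is the former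
      \<open>t ^ m\<close> coefficient, which has become a low one.\<close>
    define w where "w i = (if i < m then c * v i else 0) + (if i = m then c * ?S m else 0)
        + (if i = 0 then 0 else b * v (i - 1))" for i
    have S: "?S (Suc m) = c * b ^ Suc m + b * ?S m"
      by (subst sum.atMost_Suc_shift) (simp add: sum_distrib_left mult.assoc)
    have w: "(\<Sum>i<Suc m. t ^ i *s w i) = (\<Sum>i<m. t ^ i *s (c * v i)) + t ^ m *s (c * ?S m)
        + (\<Sum>i<m. t ^ Suc i *s (b * v i))" for t
    proof -
      have "(\<Sum>i<Suc m. t ^ i *s (if i < m then c * v i else 0)) = (\<Sum>i<m. t ^ i *s (c * v i))"
        by simp
      moreover have "(\<Sum>i<Suc m. t ^ i *s (if i = m then c * ?S m else 0)) = t ^ m *s (c * ?S m)"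
        by simp
      moreover have "(\<Sum>i<Suc m. t ^ i *s (if i = 0 then 0 else b * v (i - 1)))
          = (\<Sum>i<m. t ^ Suc i *s (b * v i))"
        by (subst sum.lessThan_Suc_shift) simp
      ultimately show ?thesis
        unfolding w_def scale_right_distrib sum.distrib by simp
    qed
    have expand: "(c + t *s b) * (t ^ Suc m *s b ^ Suc m + t ^ m *s s + (\<Sum>i<m. t ^ i *s v i))
        = t ^ Suc m *s (c * b ^ Suc m) + t ^ m *s (c * s) + (\<Sum>i<m. t ^ i *s (c * v i))
          + (t ^ Suc (Suc m) *s b ^ Suc (Suc m) + t ^ Suc m *s (b * s)
            + (\<Sum>i<m. t ^ Suc i *s (b * v i)))" for t s
      by (simp add: distrib_left distrib_right scale_mult_left scale_mult_right
          sum_distrib_left scale_sum_right scale_right_distrib sum.distrib add_ac mult_ac)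
    have "(c + t *s b) ^ Suc (Suc m) = t ^ Suc (Suc m) *s b ^ Suc (Suc m)
        + t ^ Suc m *s ?S (Suc m) + (\<Sum>i<Suc m. t ^ i *s w i)" for t
    proof -
      have "(c + t *s b) ^ Suc (Suc m) = (c + t *s b) * (c + t *s b) ^ Suc m"
        by (rule power_Suc)
      also have "\<dots> = (c + t *s b)
          * (t ^ Suc m *s b ^ Suc m + t ^ m *s ?S m + (\<Sum>i<m. t ^ i *s v i))"
        by (simp only: v)
      also have "\<dots> = t ^ Suc m *s (c * b ^ Suc m) + t ^ m *s (c * ?S m)
          + (\<Sum>i<m. t ^ i *s (c * v i))
          + (t ^ Suc (Suc m) *s b ^ Suc (Suc m) + t ^ Suc m *s (b * ?S m)
            + (\<Sum>i<m. t ^ Suc i *s (b * v i)))"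
        by (simp only: expand)
      finally show ?thesis
        unfolding w S scale_right_distrib by (simp only: add_ac)
    qed
    then show ?case
      by blast
  qed
  then show ?thesis
    using that by blast
qed

text \<open>
  In \<open>(c + t b) ^ q = c + t b\<close> the leading term \<open>t ^ q b ^ q\<close> cancels against \<open>t b\<close>.  Summing the rest over
  all \<open>t\<close> turns \<open>c\<close> into \<open>q c = 0\<close>, kills the powers below \<open>t ^ (q - 1)\<close> and gives \<open>- S\<close>, where \<open>S\<close> is the
  coefficient of \<open>t ^ (q - 1)\<close>.  So \<open>S = 0\<close>, and the commutator of \<open>b\<close> with \<open>S\<close> is that of \<open>b ^ q = b\<close> with \<open>c\<close>.
\<close>

lemma commute_if_line_power_fixed:
  assumes fin: "finite (UNIV :: 'f set)"
    and b: "b \<in> power_fixed CARD('f)"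
    and line: "\<And>t. c + t *s b \<in> power_fixed CARD('f)"
  shows "b * c = c * b"
proof -
  define m where "m = CARD('f) - 1"
  have q: "CARD('f) = Suc m"
    using two_le_card_field[OF fin] by (simp add: m_def)
  let ?S = "\<Sum>i\<le>m. b ^ i * c * b ^ (m - i)"
  obtain v where v: "\<And>t. (c + t *s b) ^ Suc m
      = t ^ Suc m *s b ^ Suc m + t ^ m *s ?S + (\<Sum>i<m. t ^ i *s v i)"
    by (rule power_on_line_expansion[of c b m]) blast
  have bq: "b ^ Suc m = b"
    using b q by (simp add: power_fixed_def)
  have tq: "t ^ Suc m = t" for t :: 'f
    using finite_field_power_card[OF fin] q by metis
  have "t *s b + c = t *s b + (t ^ m *s ?S + (\<Sum>i<m. t ^ i *s v i))" for t
    using line[of t] v[of t] unfolding bq tq q power_fixed_def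
    by (simp only: mem_Collect_eq add.assoc add.commute[of c])
  then have "c = t ^ m *s ?S + (\<Sum>i<m. t ^ i *s v i)" for t
    by (simp only: add_left_cancel)
  then have "(\<Sum>t::'f\<in>UNIV. c) = (\<Sum>t\<in>UNIV. t ^ m *s ?S + (\<Sum>i<m. t ^ i *s v i))"
    by (intro sum.cong) auto
  also have "\<dots> = (\<Sum>t\<in>UNIV. t ^ m) *s ?S + (\<Sum>i<m. (\<Sum>t\<in>UNIV. t ^ i) *s v i)"
    unfolding sum.distrib scale_sum_left by (subst (2) sum.swap) simp
  also have "\<dots> = - ?S"
    using finite_field_power_sum_eq_0[OF fin] finite_field_power_sum_card_minus_1[OF fin]
    by (simp add: q)
  also have "(\<Sum>t::'f\<in>UNIV. c) = of_nat CARD('f) *s c"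
    using sum_constant_scale[of c "UNIV :: 'f set"] by simp
  finally have "?S = 0"
    using finite_field_of_nat_card[OF fin] by simp
  then show ?thesis
    using commutator_power_eq_telescope[of b c m] unfolding bq by simp
qed

text \<open>
  A subspace contains every line through one of its points in a direction of the subspace.  Here this makes extremal
  centralizers commutative.
\<close>

lemma power_fixed_subspace_commute:
  assumes fin: "finite (UNIV :: 'f set)" and S: "subspace S"
    and fixed: "S \<subseteq> power_fixed CARD('f)" and xy: "x \<in> S" "y \<in> S"
  shows "x * y = y * x"
  using fixed xy by (intro commute_if_line_power_fixed[OF fin])
    (auto intro!: subsetD[OF fixed] subspace_add[OF S] subspace_scale[OF S])

section \<open>Counting along lines in direction of a solution\<close>

lemma subspace_centralizer: "subspace (centralizer b)"
  by (rule subspaceI)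
    (auto simp: centralizer_def distrib_left distrib_right scale_mult_left scale_mult_right)

lemma subspace_ring_center: "subspace ring_center"
  by (rule subspaceI)
    (auto simp: ring_center_def distrib_left distrib_right scale_mult_left scale_mult_right)

text \<open>
  This map parametrizes \<open>S + F v\<close>.  Counting its image replaces dimension arguments: a proper subspace has at most
  \<open>N / q\<close> elements, and when it has that many, one further vector completes it to the whole algebra.
\<close>

lemma inj_on_subspace_plus_line:
  assumes S: "subspace S" and v: "v \<notin> S"
  shows "inj_on (\<lambda>(t, s). s + t *s v) (UNIV \<times> S)"
proof (rule inj_onI, clarify)
  fix t t' s s'
  assume s: "s \<in> S" "s' \<in> S" and eq: "s + t *s v = s' + t' *s v"
  have "(t - t') *s v = s' - s"
    using eq by (simp add: algebra_simps)
  then have *: "(t - t') *s v \<in> S"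
    using s S by (simp add: subspace_diff)
  have "t = t'"
  proof (rule ccontr)
    assume "t \<noteq> t'"
    then have "v = inverse (t - t') *s ((t - t') *s v)"
      by simp
    then show False
      using * S v subspace_scale by metis
  qed
  then show "t = t' \<and> s = s'"
    using eq by simp
qed

lemma card_proper_subspace_le:
  assumes fin: "finite (UNIV :: 'r set)" and S: "subspace S" and v: "v \<notin> S"
  shows "CARD('f) * card S \<le> CARD('r)"
proof -
  have "CARD('f) * card S = card ((\<lambda>(t, s). s + t *s v) ` (UNIV \<times> S))"
    by (simp add: card_image[OF inj_on_subspace_plus_line[OF S v]] card_cartesian_product)
  also have "\<dots> \<le> CARD('r)"
    using fin by (intro card_mono) auto
  finally show ?thesis .
qed

lemma subspace_plus_line_eq_UNIV:
  assumes fin: "finite (UNIV :: 'r set)" and S: "subspace S" and v: "v \<notin> S"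
    and card: "CARD('f) * card S = CARD('r)"
  obtains s t where "s \<in> S" "x = s + t *s v"
proof -
  have "card ((\<lambda>(t, s). s + t *s v) ` (UNIV \<times> S)) = CARD('r)"
    by (simp add: card_image[OF inj_on_subspace_plus_line[OF S v]] card_cartesian_product card)
  then have "(\<lambda>(t, s). s + t *s v) ` (UNIV \<times> S) = UNIV"
    using fin by (intro card_subset_eq) auto
  then have "x \<in> (\<lambda>(t, s). s + t *s v) ` (UNIV \<times> S)"
    by simp
  then show ?thesis
    using that by auto
qed

text \<open>
  Each element outside the centralizer of \<open>b\<close> has a translate by a multiple of \<open>b\<close> which is not in \<open>I\<close> and is
  still outside the centralizer.  So \<open>q\<close> translates of the set \<open>Bad\<close> of such elements cover the
  complement of the centralizer.  The term \<open>card (centralizer b - I)\<close> is kept in order to read off the case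
  of equality.
\<close>

lemma card_power_fixed_centralizer_bound:
  assumes finF: "finite (UNIV :: 'f set)" and finR: "finite (UNIV :: 'r set)"
    and b: "b \<in> power_fixed CARD('f)"
  defines "I \<equiv> power_fixed CARD('f) :: 'r set"
  shows "CARD('f) * (card I + card (centralizer b - I)) + CARD('r)
    \<le> CARD('f) * CARD('r) + card (centralizer b)"
proof -
  define Z where "Z = centralizer b"
  define Bad where "Bad = - (Z \<union> I)"
  have fin: "finite A" for A :: "'r set"
    using finR by (rule finite_subset[rotated]) simp
  have "- Z \<subseteq> (\<lambda>(t, y). y - t *s b) ` (UNIV \<times> Bad)"
  proof
    fix x
    assume x: "x \<in> - Z"
    then have "b * x \<noteq> x * b"
      by (simp add: Z_def centralizer_def)
    then obtain t where t: "x + t *s b \<notin> I"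
      using commute_if_line_power_fixed[OF finF b] unfolding I_def by blast
    have "x + t *s b \<notin> Z"
      using x by (simp add: Z_def centralizer_def distrib_left distrib_right
          scale_mult_left scale_mult_right)
    with t have "x + t *s b \<in> Bad"
      by (simp add: Bad_def)
    then show "x \<in> (\<lambda>(t, y). y - t *s b) ` (UNIV \<times> Bad)"
      by (intro image_eqI[where x = "(t, x + t *s b)"]) auto
  qed
  then have "card (- Z) \<le> card ((\<lambda>(t, y). y - t *s b) ` (UNIV \<times> Bad))"
    by (intro card_mono) (auto simp: fin finF)
  also have "\<dots> \<le> card ((UNIV :: 'f set) \<times> Bad)"
    by (intro card_image_le) (auto simp: fin finF)
  finally have 1: "card (- Z) \<le> CARD('f) * card Bad"
    by (simp add: card_cartesian_product)
  have 2: "CARD('r) = card Z + card (- Z)"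
    using card_Un_disjoint[of Z "- Z"] by (simp add: fin Compl_partition)
  have "UNIV = (I \<union> (Z - I)) \<union> Bad"
    by (auto simp: Bad_def)
  then have 3: "CARD('r) = card I + card (Z - I) + card Bad"
    by (metis (no_types, lifting) Bad_def Diff_disjoint Un_Diff_cancel card_Un_disjoint
        compl_sup_top fin inf_compl_bot sup_commute)
  have "CARD('f) * CARD('r) = CARD('f) * (card I + card (Z - I)) + CARD('f) * card Bad"
    by (subst 3) (simp add: distrib_left)
  then show ?thesis
    using 1 2 unfolding Z_def by linarith
qed

text \<open>
  The inequality \<open>card I / N \<le> (q^2 - q + 1) / q^2\<close> without division or subtraction.  It adds up two
  estimates, the preceding count and \<open>q * card (centralizer b) \<le> N\<close>, and so equality makes both of them sharp.
\<close>

lemma extremal_centralizer: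
  assumes finF: "finite (UNIV :: 'f set)" and finR: "finite (UNIV :: 'r set)"
    and b: "b \<in> power_fixed CARD('f)" and noncentral: "x * b \<noteq> b * x"
  defines "q \<equiv> CARD('f)" and "N \<equiv> CARD('r)" and "I \<equiv> power_fixed CARD('f) :: 'r set"
  shows "q * q * card I + q * N \<le> q * q * N + N"
    and "q * q * card I + q * N = q * q * N + N \<Longrightarrow> centralizer b \<subseteq> I"
    and "q * q * card I + q * N = q * q * N + N \<Longrightarrow> q * card (centralizer b) = N"
proof -
  have "q * (q * (card I + card (centralizer b - I)) + N) \<le> q * (q * N + card (centralizer b))"
    using card_power_fixed_centralizer_bound[OF finF finR b]
    unfolding q_def N_def I_def by (rule mult_le_mono2)
  then have 1: "q * q * card I + q * q * card (centralizer b - I) + q * N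
      \<le> q * q * N + q * card (centralizer b)"
    by (simp add: algebra_simps)
  have 2: "q * card (centralizer b) \<le> N"
    unfolding q_def N_def using noncentral
    by (intro card_proper_subspace_le[OF finR subspace_centralizer]) (simp add: centralizer_def)
  show "q * q * card I + q * N \<le> q * q * N + N"
    using 1 2 by linarith
  assume eq: "q * q * card I + q * N = q * q * N + N"
  show "q * card (centralizer b) = N"
    using 1 2 eq by linarith
  have "q * q * card (centralizer b - I) = 0"
    using 1 2 eq by linarith
  moreover have "q > 0"
    using two_le_card_field[OF finF] by (simp add: q_def)
  moreover have "finite (centralizer b - I)"
    using finR by (rule finite_subset[rotated]) simp
  ultimately show "centralizer b \<subseteq> I"
    by simp
qed

section \<open>Structure in the extremal case\<close>

text \<open>
  Each hyperplane together with the other element spans the algebra: \<open>R = Z b + F c = Z c + F b\<close>, where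
  \<open>Z x\<close> is the centralizer of \<open>x\<close>.  As \<open>Z b\<close> is commutative, the first decomposition shows that
  \<open>Z b \<inter> Z c\<close> is central.  Intersecting the second one with \<open>Z b\<close>, which contains \<open>b\<close>, gives
  \<open>Z b = C + F b\<close> for the center \<open>C\<close>, and then \<open>R = C + F b + F c\<close>.
\<close>

lemma
  assumes finF: "finite (UNIV :: 'f set)" and finR: "finite (UNIV :: 'r set)"
    and bc: "b * c \<noteq> c * b"
    and fixed: "centralizer b \<subseteq> power_fixed CARD('f)"
    and card_b: "CARD('f) * card (centralizer b) = CARD('r)"
    and card_c: "CARD('f) * card (centralizer c) = CARD('r)"
  shows card_centralizer_eq_card_center:
      "card (centralizer b) = CARD('f) * card (ring_center :: 'r set)"
    and generated_by_center_and_pair: "generated_algebra scale (ring_center \<union> {b, c}) = UNIV"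
proof -
  have b_notin: "b \<notin> centralizer c" and c_notin: "c \<notin> centralizer b"
    using bc by (auto simp: centralizer_def)
  have R_eq: "\<exists>s t. s \<in> centralizer b \<and> y = s + t *s c" for y
    using subspace_plus_line_eq_UNIV[OF finR subspace_centralizer c_notin card_b] by metis
  have R_eq': "\<exists>s t. s \<in> centralizer c \<and> y = s + t *s b" for y
    using subspace_plus_line_eq_UNIV[OF finR subspace_centralizer b_notin card_c] by metis
  have center: "z \<in> ring_center" if z: "z \<in> centralizer b" "z \<in> centralizer c" for z
  proof -
    have "z * y = y * z" for y
    proof -
      obtain s t where s: "s \<in> centralizer b" "y = s + t *s c"
        using R_eq by blast
      have "z * s = s * z"
        using power_fixed_subspace_commute[OF finF subspace_centralizer fixed z(1) s(1)] .
      moreover have "z * c = c * z"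
        using z(2) by (simp add: centralizer_def)
      ultimately show ?thesis
        by (simp add: s(2) distrib_left distrib_right scale_mult_left scale_mult_right)
    qed
    then show ?thesis
      by (simp add: ring_center_def)
  qed
  have b_in: "b \<in> centralizer b"
    by (simp add: centralizer_def)
  have center_sub: "ring_center \<subseteq> centralizer b"
    by (auto simp: ring_center_def centralizer_def)
  have Zb_eq: "\<exists>z t. z \<in> ring_center \<and> y = z + t *s b" if y: "y \<in> centralizer b" for y
  proof -
    obtain z t where z: "z \<in> centralizer c" "y = z + t *s b"
      using R_eq' by blast
    have "z = y - t *s b"
      using z(2) by simp
    also have "\<dots> \<in> centralizer b"
      using y b_in by (intro subspace_diff subspace_scale subspace_centralizer)
    finally show ?thesis
      using center z by blast
  qed
  have b_noncentral: "b \<notin> ring_center"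
    using bc unfolding ring_center_def by blast
  have "(\<lambda>(t, z). z + t *s b) ` (UNIV \<times> ring_center) = centralizer b"
  proof (intro subset_antisym subsetI)
    fix y
    assume "y \<in> (\<lambda>(t, z). z + t *s b) ` (UNIV \<times> ring_center)"
    then show "y \<in> centralizer b"
      using center_sub b_in
      by (auto intro!: subspace_add subspace_scale subspace_centralizer)
  next
    fix y
    assume "y \<in> centralizer b"
    then show "y \<in> (\<lambda>(t, z). z + t *s b) ` (UNIV \<times> ring_center)"
      using Zb_eq by fastforce
  qed
  then show "card (centralizer b) = CARD('f) * card (ring_center :: 'r set)"
    using card_image[OF inj_on_subspace_plus_line[OF subspace_ring_center b_noncentral]]
    by (simp add: card_cartesian_product)
  have "y \<in> T" if T: "unital_subalgebra scale T" "ring_center \<union> {b, c} \<subseteq> T" for T y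
  proof -
    obtain s t where s: "s \<in> centralizer b" "y = s + t *s c"
      using R_eq by blast
    obtain z u where z: "z \<in> ring_center" "s = z + u *s b"
      using Zb_eq[OF s(1)] by blast
    have "subspace T"
      using T(1) by (simp add: unital_subalgebra_def)
    then show ?thesis
      unfolding s(2) z(2) using T(2) z(1)
      by (intro subspace_add subspace_scale) auto
  qed
  then show "generated_algebra scale (ring_center \<union> {b, c}) = UNIV"
    by (auto simp: generated_algebra_def hull_def)
qed

end

text \<open>
  The gap is at least \<open>(q - 1)^2 * N\<close>.  This excludes equality when \<open>I\<close> is contained in a proper subspace.
\<close>

lemma nat_extremal_strict:
  fixes q N i :: nat
  assumes "2 \<le> q" "0 < N" "q * i \<le> N"
  shows "q * q * i + q * N < q * q * N + N"
proof -
  obtain m where m: "q = Suc m" "0 < m"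
    using assms(1) by (cases q) auto
  have "q * q * i \<le> q * N"
    unfolding mult.assoc using assms(3) by (rule mult_le_mono2)
  moreover have "q * N + q * N < q * q * N + N"
    using m assms(2) by (simp add: algebra_simps)
  ultimately show ?thesis
    by linarith
qed

theorem theorem2p1:
  fixes scale :: "'f::{field,finite} \<Rightarrow> 'r::{ring_1,finite} \<Rightarrow> 'r"
    and q n :: nat
  assumes "unital_algebra scale"
    and "CARD('f) = q"
    and "CARD('r) = q ^ n"
    and "\<exists>x y :: 'r. x * y \<noteq> y * x"
  shows "power_fixed_ratio TYPE('r) q \<le> (real q ^ 2 - real q + 1) / real q ^ 2 \<and>
    (power_fixed_ratio TYPE('r) q = (real q ^ 2 - real q + 1) / real q ^ 2 \<longrightarrow>
      (\<exists>b c :: 'r. b \<in> power_fixed q \<and> c \<in> power_fixed q \<and> b * c \<noteq> c * b \<and>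
        generated_algebra scale (ring_center \<union> {b, c}) = UNIV \<and>
        (ring_center :: 'r set) \<subseteq> power_fixed q \<and>
        card (ring_center :: 'r set) = q ^ (n - 2) \<and>
        card (centralizer b) = q ^ (n - 1) \<and>
        card (centralizer c) = q ^ (n - 1)))"
proof -
  interpret unital_algebra scale
    by (rule assms(1))
  define I where "I = (power_fixed q :: 'r set)"
  define N where "N = CARD('r)"
  have finF: "finite (UNIV :: 'f set)" and finR: "finite (UNIV :: 'r set)"
    by simp_all
  have q: "2 \<le> q"
    using two_le_card_field[OF finF] assms(2) by simp
  have N: "0 < N"
    by (simp add: N_def)
  have I: "power_fixed CARD('f) = I"
    by (simp add: I_def assms(2))
  note extremal = extremal_centralizer[OF finF finR, unfolded I, unfolded assms(2), folded N_def]
  have ratio: "power_fixed_ratio TYPE('r) q = real (card I) / real N"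
    by (simp add: power_fixed_ratio_def I_def N_def)
  have ratio_le_iff: "power_fixed_ratio TYPE('r) q \<le> (real q ^ 2 - real q + 1) / real q ^ 2
      \<longleftrightarrow> q * q * card I + q * N \<le> q * q * N + N"
  proof -
    have "power_fixed_ratio TYPE('r) q \<le> (real q ^ 2 - real q + 1) / real q ^ 2
        \<longleftrightarrow> real (q * q * card I + q * N) \<le> real (q * q * N + N)"
      unfolding ratio using q N by (simp add: field_simps power2_eq_square)
    then show ?thesis
      by (simp only: of_nat_le_iff)
  qed
  have ratio_eq_iff: "power_fixed_ratio TYPE('r) q = (real q ^ 2 - real q + 1) / real q ^ 2
      \<longleftrightarrow> q * q * card I + q * N = q * q * N + N"
  proof -
    have "power_fixed_ratio TYPE('r) q = (real q ^ 2 - real q + 1) / real q ^ 2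
        \<longleftrightarrow> real (q * q * card I + q * N) = real (q * q * N + N)"
      unfolding ratio using q N by (simp add: field_simps power2_eq_square)
    then show ?thesis
      by (simp only: of_nat_eq_iff)
  qed
  have in_centralizer: "q * q * card I + q * N < q * q * N + N"
    if "I \<subseteq> centralizer x" "x * y \<noteq> y * x" for x y
  proof -
    have "card I \<le> card (centralizer x)"
      using that(1) by (intro card_mono) auto
    moreover have "y \<notin> centralizer x"
      using that(2) by (simp add: centralizer_def)
    then have "q * card (centralizer x) \<le> N"
      using card_proper_subspace_le[OF finR subspace_centralizer] assms(2) by (simp add: N_def)
    ultimately have "q * card I \<le> N"
      by (meson le_trans mult_le_mono2)
    then show ?thesis
      by (rule nat_extremal_strict[OF q N])
  qed
  show ?thesis
  proof (cases "\<exists>b\<in>I. \<exists>x. x * b \<noteq> b * x")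
    case False
    obtain x y :: 'r where xy: "x * y \<noteq> y * x"
      using assms(4) by blast
    have "I \<subseteq> centralizer x"
      using False by (auto simp: centralizer_def)
    then show ?thesis
      using in_centralizer[OF _ xy] unfolding ratio_le_iff ratio_eq_iff by simp
  next
    case True
    then obtain b x where b: "b \<in> I" "x * b \<noteq> b * x"
      by blast
    have "\<exists>b c :: 'r. b \<in> I \<and> c \<in> I \<and> b * c \<noteq> c * b \<and>
        generated_algebra scale (ring_center \<union> {b, c}) = UNIV \<and>
        (ring_center :: 'r set) \<subseteq> I \<and>
        card (ring_center :: 'r set) = q ^ (n - 2) \<and>
        card (centralizer b) = q ^ (n - 1) \<and>
        card (centralizer c) = q ^ (n - 1)"
      if eq: "q * q * card I + q * N = q * q * N + N"
    proof -
      have "\<not> I \<subseteq> centralizer b"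
        using in_centralizer[of b x] b(2) eq by auto
      then obtain c where c: "c \<in> I" "c * b \<noteq> b * c"
        by (auto simp: centralizer_def)
      have Zb: "centralizer b \<subseteq> I" "q * card (centralizer b) = N"
        using extremal(2,3)[OF b(1) c(2) eq] .
      have Zc: "centralizer c \<subseteq> I" "q * card (centralizer c) = N"
        using extremal(2,3)[OF c(1) c(2)[symmetric] eq] .
      have card_Zb: "card (centralizer b) = q * card (ring_center :: 'r set)"
        using card_centralizer_eq_card_center[OF finF finR c(2)[symmetric]] Zb Zc(2) assms(2)
        by (simp add: N_def I_def)
      have N_eq: "N = q ^ n"
        by (simp add: N_def assms(3))
      have "card (ring_center :: 'r set) > 0"
        using subspace_0[OF subspace_ring_center] by (auto simp: card_gt_0_iff)
      \<comment> \<open>This gives \<open>n \<ge> 2\<close>, so that \<open>n - 1\<close> and \<open>n - 2\<close> are not truncated.\<close>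
      then have "q * q \<le> q ^ n"
        unfolding N_eq[symmetric] Zb(2)[symmetric] card_Zb by simp
      then have "2 \<le> n"
        using q power_le_imp_le_exp[of q 2 n] by (simp add: power2_eq_square)
      then have "n = Suc (Suc (n - 2))"
        by simp
      then obtain m where m: "n = Suc (Suc m)"
        by blast
      have cards: "card (centralizer b) = q ^ (n - 1)" "card (centralizer c) = q ^ (n - 1)"
        using Zb(2) Zc(2) q unfolding N_eq m by simp_all
      then have card_center: "card (ring_center :: 'r set) = q ^ (n - 2)"
        using card_Zb q unfolding m by simp
      have "generated_algebra scale (ring_center \<union> {b, c}) = UNIV"
        using generated_by_center_and_pair[OF finF finR c(2)[symmetric]] Zb Zc(2) assms(2)
        by (simp add: N_def I_def)
      moreover have "ring_center \<subseteq> centralizer b"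
        by (auto simp: ring_center_def centralizer_def)
      ultimately show ?thesis
        using b(1) c cards card_center Zb(1) by (intro exI[of _ b] exI[of _ c]) auto
    qed
    then show ?thesis
      using extremal(1)[OF b] unfolding ratio_le_iff ratio_eq_iff I_def by blast
  qed
qed

end
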